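(* Let $q\in\mathbb{C}$ with $|q|<1$, fix a square root $q^{1/2}$ of $q$, and set $q^{m/2}=(q^{1/2})^m$ for integers $m\ge 0$. Let $$A_1(q)=\frac{f(-q^4, -q^{14})}{f(-q^5, -q^{13})},\quad A_2(q)=\frac{f(-q^3, -q^{15})}{f(-q^6, -q^{12})},\quad A_3(q)=\frac{f(-q^2, -q^{16})}{f(-q^7, -q^{11})},\quad A_4(q)=\frac{f(-q, -q^{17})}{f(-q^8, -q^{10})}.$$ Then the following hold, where in each of (i)--(iv) either all upper signs or all lower signs are taken (so each is two identities): (i) $\dfrac{1}{A_1(q)} \mp q^{1/2}A_1(q)= \dfrac{f(\mp q^{1/2}, \mp q^{17/2})\, \varphi(\pm q^{9/2})}{f(-q^4, -q^5)\, \psi(q^9)}$; (ii) $\dfrac{1}{A_2(q)} \mp q^{3/2}A_2(q)= \dfrac{f(\mp q^{3/2}, \mp q^{15/2})\, \varphi(\pm q^{9/2})}{f(-q^3, -q^6)\, \psi(q^9)}$; (iii) $\dfrac{1}{A_3(q)} \mp q^{5/2}A_3(q)= \dfrac{f(\mp q^{5/2}, \mp q^{13/2})\, \varphi(\pm q^{9/2})}{f(-q^2, -q^7)\, \psi(q^9)}$; (iv) $\dfrac{1}{A_4(q)} \mp q^{7/2}A_4(q)= \dfrac{f(\mp q^{7/2}, \mp q^{11/2})\, \varphi(\pm q^{9/2})}{f(-q, -q^8)\, \psi(q^9)}$; (v) $\displaystyle \prod_{i\in\{1,3,4\}}\left(\frac{1}{A_i(q)}+q^{(2i-1)/2}A_i(q)\right)=\frac{\varphi^3(-q^{9/2})}{\psi^3(q^9)\,(q,q^2;q^3)_\infty}\prod_{i\in\{1,3,4\}}\left(-q^{(2i-1)/2},\,-q^{9-(2i-1)/2};\,q^9\right)_\infty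 .$
   Context: Ramanujan's general theta function is $f(a,b)=\sum_{n=-\infty}^{\infty} a^{n(n+1)/2}b^{n(n-1)/2}$ for $|ab|<1$ (with the convention $0^0=1$). Also $\varphi(q)=f(q,q)=\sum_{n=-\infty}^\infty q^{n^2}$ and $\psi(q)=f(q,q^3)=\sum_{n=0}^{\infty} q^{n(n+1)/2}$ for $|q|<1$. For $|q|<1$, $(\lambda;q)_\infty=\prod_{j=0}^{\infty}(1-\lambda q^j)$ and $(\lambda_1,\lambda_2;q)_\infty=(\lambda_1;q)_\infty(\lambda_2;q)_\infty$. *)

theory Defs
  imports "HOL-Analysis.Analysis"
begin

text \<open>
  Ramanujan's general theta function, meant for \<open>norm (a * b) < 1\<close>.  For an integer \<open>n\<close>
  both \<open>n * (n + 1) div 2\<close> and \<open>n * (n - 1) div 2\<close> are exact and nonnegative, so neither the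
  integer division nor \<open>nat\<close> truncates; the convention on \<open>0 ^ 0\<close> is the library's.
\<close>

definition ramanujan_f :: "complex \<Rightarrow> complex \<Rightarrow> complex" where
  "ramanujan_f a b =
     (\<Sum>\<^sub>\<infinity>n\<in>(UNIV :: int set). a ^ nat (n * (n + 1) div 2) * b ^ nat (n * (n - 1) div 2))"

definition ramanujan_phi :: "complex \<Rightarrow> complex" where
  "ramanujan_phi q = ramanujan_f q q"

definition ramanujan_psi :: "complex \<Rightarrow> complex" where
  "ramanujan_psi q = ramanujan_f q (q ^ 3)"

definition qpoch_inf :: "complex \<Rightarrow> complex \<Rightarrow> complex" where
  "qpoch_inf l q = (\<Prod>j. 1 - l * q ^ j)"

definition qpoch_inf2 :: "complex \<Rightarrow> complex \<Rightarrow> complex \<Rightarrow> complex" where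
  "qpoch_inf2 l1 l2 q = qpoch_inf l1 q * qpoch_inf l2 q"

text \<open>
  Only the indices 1 to 4 are meaningful (the subtraction on \<open>nat\<close> is exact there); the lemma
  below lists these four functions explicitly.
\<close>

definition A :: "nat \<Rightarrow> complex \<Rightarrow> complex" where
  "A i q = ramanujan_f (- (q ^ (5 - i))) (- (q ^ (13 + i))) /
           ramanujan_f (- (q ^ (4 + i))) (- (q ^ (14 - i)))"

lemma A_explicit:
  "A 1 q = ramanujan_f (- (q ^ 4)) (- (q ^ 14)) / ramanujan_f (- (q ^ 5)) (- (q ^ 13))"
  "A 2 q = ramanujan_f (- (q ^ 3)) (- (q ^ 15)) / ramanujan_f (- (q ^ 6)) (- (q ^ 12))"
  "A 3 q = ramanujan_f (- (q ^ 2)) (- (q ^ 16)) / ramanujan_f (- (q ^ 7)) (- (q ^ 11))"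
  "A 4 q = ramanujan_f (- q) (- (q ^ 17)) / ramanujan_f (- (q ^ 8)) (- (q ^ 10))"
  by (simp_all add: A_def)

end

theory Submission
  imports Defs
begin

text \<open>
  Put \<open>s\<^sup>2 = q\<close>, \<open>c = s ^ 9\<close> and \<open>x = s ^ k\<close> with \<open>k = 2 * i - 1 \<in> {1, 3, 5, 7}\<close>, so that \<open>c\<^sup>2 = q ^ 9\<close>.
  In these variables \<open>A i q = G / F\<close> where \<open>F = f(-c x, -c\<^sup>3/x)\<close> and \<open>G = f(-c/x, -c\<^sup>3 x)\<close>, and
  (i)--(iv) become one identity in \<open>c\<close>, \<open>x\<close> and the sign \<open>e\<close>.  It is the quotient of

  \<^item> \<open>F\<^sup>2 - e x G\<^sup>2 = f(-e x, -e c\<^sup>2/x) \<phi>(e c)\<close>, and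
  \<^item> \<open>F G = f(-c/x, -c x) \<psi>(c\<^sup>2)\<close>.

  Both come from Ramanujan's formula for a product \<open>f(a, b) f(c, d)\<close> with \<open>a b = c d\<close>
  (\<open>theta_product\<close>): the double series is indexed by a pair of integers, and splitting the pairs
  by the parity of their sum turns each half into a product of two theta series again.  For the first
  identity the formula is read from right to left.  For the second it produces \<open>\<psi>(c\<^sup>2)\<close> times a sum of
  two theta functions, which is the splitting of \<open>f(-c x, -c/x)\<close> into its even and odd terms
  (\<open>theta_dissection\<close>).

  Dividing requires \<open>F\<close> and \<open>G\<close> to be nonzero, which is read off from Jacobi's triple product
  (\<open>jacobi_triple_product\<close>).  The triple product also gives (v) from (i), (iii) and (iv) with the
  lower signs: the three factors \<open>(q ^ 9; q ^ 9)\<close> of the numerator cancel those of the denominator, and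
  the remaining factors \<open>(q ^ j; q ^ 9)\<close> of the denominator run over the residues \<open>j\<close> modulo 9 prime
  to 3, so that their product is \<open>(q, q\<^sup>2; q\<^sup>3)\<close>.

  The triple product itself is the limit of a finite identity whose coefficients are
  \<open>q\<close>-binomial coefficients (\<open>finite_triple_product\<close>).  The parametrisation needs \<open>s \<noteq> 0\<close>; for
  \<open>q = 0\<close> every theta function involved equals 1.
\<close>

section \<open>The theta series and its convergence\<close>

definition theta_term :: "complex \<Rightarrow> complex \<Rightarrow> int \<Rightarrow> complex" where
  "theta_term a b k = a ^ nat (k * (k + 1) div 2) * b ^ nat (k * (k - 1) div 2)"

lemma ramanujan_f_theta_term: "ramanujan_f a b = infsum (theta_term a b) UNIV"
  by (simp add: ramanujan_f_def theta_term_def [abs_def])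

lemma of_nat_triangular:
  fixes k :: int
  shows "(of_nat (nat (k * (k + 1) div 2)) :: complex) = of_int k * (of_int k + 1) / 2"
proof -
  have nonneg: "0 \<le> k * (k + 1)"
    by (cases "k \<ge> 0") (auto simp: mult_nonpos_nonpos)
  have "even (k * (k + 1))" by simp
  then have "2 * (k * (k + 1) div 2) = k * (k + 1)" by simp
  then have "2 * (of_int (k * (k + 1) div 2) :: complex) = of_int (k * (k + 1))"
    by (metis of_int_mult of_int_numeral)
  then have "of_int (k * (k + 1) div 2) = of_int k * (of_int k + 1) / (2 :: complex)"
    by (metis nonzero_mult_div_cancel_left of_int_1 of_int_add of_int_mult zero_neq_numeral)
  moreover have "0 \<le> k * (k + 1) div 2"
    using nonneg by (simp only: pos_imp_zdiv_nonneg_iff)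
  ultimately show ?thesis by (simp only: of_nat_nat)
qed

text \<open>
  Writing the two arguments as exponentials turns every identity between theta terms below into an
  identity between polynomials in the summation indices, and hides the integer divisions.
\<close>

lemma theta_term_exp:
  "theta_term (exp \<alpha>) (exp \<beta>) k =
     exp (\<alpha> * (of_int k * (of_int k + 1) / 2) + \<beta> * (of_int k * (of_int k - 1) / 2))"
proof -
  have "k * (k - 1) = (- k) * (- k + 1)" by (simp add: algebra_simps)
  then have "(of_nat (nat (k * (k - 1) div 2)) :: complex) = of_int k * (of_int k - 1) / 2"
    using of_nat_triangular [of "- k"] by (simp only:) (simp add: algebra_simps)
  then show ?thesis
    unfolding theta_term_def exp_of_nat2_mult [symmetric] of_nat_triangular
    by (simp only: exp_add)
qed

lemma theta_term_uminus: "theta_term a b (- k) = theta_term b a k"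
  by (simp add: theta_term_def algebra_simps)

lemma ramanujan_f_commute: "ramanujan_f a b = ramanujan_f b a"
  unfolding ramanujan_f_theta_term
  by (rule infsum_reindex_bij_witness [of _ uminus uminus]) (simp_all add: theta_term_uminus)

lemma theta_term_step:
  "theta_term a b (int n + 1) = theta_term a b (int n) * (a * (a * b) ^ n)"
proof -
  have 1: "nat ((int n + 1) * (int n + 1 + 1) div 2) = nat (int n * (int n + 1) div 2) + Suc n"
    and 2: "nat ((int n + 1) * (int n + 1 - 1) div 2) = nat (int n * (int n - 1) div 2) + n"
  proof -
    have "(int n + 1) * (int n + 1 + 1) = int n * (int n + 1) + (int n + 1) * 2"
      and "(int n + 1) * (int n + 1 - 1) = int n * (int n - 1) + int n * 2"
      by (simp_all add: algebra_simps)
    moreover have "0 \<le> int n * (int n + 1) div 2" "0 \<le> int n * (int n - 1) div 2"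
      by (cases n; simp)+
    ultimately show "nat ((int n + 1) * (int n + 1 + 1) div 2) = nat (int n * (int n + 1) div 2) + Suc n"
      and "nat ((int n + 1) * (int n + 1 - 1) div 2) = nat (int n * (int n - 1) div 2) + n"
      by (simp_all add: nat_add_distrib)
  qed
  show ?thesis
    unfolding theta_term_def 1 2 by (simp add: power_add power_mult_distrib mult_ac)
qed

text \<open>
  The ratio of consecutive terms tends to 0 because it contains \<open>(a * b) ^ n\<close>.
\<close>

lemma summable_theta_term_nat:
  assumes "norm (a * b) < 1"
  shows "summable (\<lambda>n. norm (theta_term a b (int n)))"
proof -
  have "(\<lambda>n. norm (a * (a * b) ^ n)) \<longlonglongrightarrow> norm (a * 0)"
    by (intro tendsto_intros LIMSEQ_power_zero assms)
  then have "eventually (\<lambda>n. norm (a * (a * b) ^ n) < 1 / 2) sequentially"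
    by (rule order_tendstoD) simp
  then obtain N where N: "\<And>n. n \<ge> N \<Longrightarrow> norm (a * (a * b) ^ n) < 1 / 2"
    by (auto simp: eventually_sequentially)
  show ?thesis
  proof (rule summable_ratio_test [where c = "1 / 2" and N = N])
    fix n assume "N \<le> n"
    have "norm (theta_term a b (int n)) * norm (a * (a * b) ^ n)
        \<le> norm (theta_term a b (int n)) * (1 / 2)"
      by (rule mult_left_mono) (use N [OF \<open>N \<le> n\<close>] in auto)
    then show "norm (norm (theta_term a b (int (Suc n))))
        \<le> 1 / 2 * norm (norm (theta_term a b (int n)))"
      using theta_term_step [of a b n] by (simp add: norm_mult add.commute)
  qed simp
qed

lemma theta_term_abs_summable:
  assumes "norm (a * b) < 1"
  shows "(\<lambda>k. norm (theta_term a b k)) summable_on UNIV"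
proof -
  have half: "(\<lambda>k. norm (theta_term c d k)) summable_on {0..}" if "norm (c * d) < 1" for c d
  proof -
    have "(\<lambda>n. norm (theta_term c d (int n))) summable_on UNIV"
      by (rule norm_summable_imp_summable_on) (use summable_theta_term_nat [OF that] in simp)
    moreover have "bij_betw int UNIV {0..}"
      by (rule bij_betwI [of _ _ _ nat]) auto
    ultimately show ?thesis
      using summable_on_reindex_bij_betw [of int UNIV "{0..}" "\<lambda>k. norm (theta_term c d k)"] by blast
  qed
  have "(\<lambda>k. norm (theta_term b a k)) summable_on {0..}"
    by (rule half) (use assms in \<open>simp add: mult.commute\<close>)
  moreover have "bij_betw uminus {..0::int} {0..}"
    by (rule bij_betwI [of _ _ _ uminus]) auto
  ultimately have "(\<lambda>k. norm (theta_term a b k)) summable_on {..0}"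
    using summable_on_reindex_bij_betw [of uminus "{..0::int}" "{0..}" "\<lambda>k. norm (theta_term b a k)"]
    by (simp add: theta_term_uminus)
  with half [OF assms] have "(\<lambda>k. norm (theta_term a b k)) summable_on ({0..} \<union> {..0})"
    by (rule summable_on_union)
  moreover have "{0..} \<union> {..0} = (UNIV :: int set)" by auto
  ultimately show ?thesis by simp
qed

lemma theta_term_summable: "norm (a * b) < 1 \<Longrightarrow> theta_term a b summable_on UNIV"
  using theta_term_abs_summable abs_summable_summable by blast

section \<open>Splitting theta series by parity\<close>

lemma
  fixes f :: "'a \<Rightarrow> complex" and g :: "'b \<Rightarrow> complex"
  assumes f: "(\<lambda>x. norm (f x)) summable_on UNIV" and g: "(\<lambda>y. norm (g y)) summable_on UNIV"
  shows summable_on_product: "(\<lambda>(x, y). f x * g y) summable_on UNIV"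
    and infsum_product: "(\<Sum>\<^sub>\<infinity>(x, y)\<in>UNIV. f x * g y) = infsum f UNIV * infsum g UNIV"
proof -
  have "(\<lambda>z. norm ((\<lambda>(x, y). f x * g y) z)) summable_on (UNIV \<times> UNIV)"
    unfolding Infinite_Sum.abs_summable_on_Sigma_iff
    by (auto simp: norm_mult infsum_cmult_right' infsum_nonneg
      intro!: summable_on_cmult_right summable_on_cmult_left f g)
  then have *: "(\<lambda>(x, y). f x * g y) summable_on (UNIV \<times> UNIV)"
    by (rule abs_summable_summable)
  then show "(\<lambda>(x, y). f x * g y) summable_on UNIV" by simp
  from * have "(\<Sum>\<^sub>\<infinity>(x, y)\<in>UNIV \<times> UNIV. f x * g y) = (\<Sum>\<^sub>\<infinity>x. \<Sum>\<^sub>\<infinity>y. f x * g y)"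
    by (subst infsum_Sigma'_banach) auto
  then show "(\<Sum>\<^sub>\<infinity>(x, y)\<in>UNIV. f x * g y) = infsum f UNIV * infsum g UNIV"
    by (simp add: infsum_cmult_right' infsum_cmult_left')
qed

lemma infsum_split_bij:
  fixes F :: "'a \<Rightarrow> complex"
  assumes "F summable_on UNIV" and "bij_betw g UNIV E" and "bij_betw h UNIV (- E)"
  shows "infsum F UNIV = infsum (\<lambda>x. F (g x)) UNIV + infsum (\<lambda>x. F (h x)) UNIV"
proof -
  have "infsum F (E \<union> - E) = infsum F E + infsum F (- E)"
    using assms(1) by (intro infsum_Un_disjoint summable_on_subset_banach [OF assms(1)]) auto
  then show ?thesis
    using infsum_reindex_bij_betw [OF assms(2), of F] infsum_reindex_bij_betw [OF assms(3), of F]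
    by simp
qed

text \<open>
  The substitutions \<open>(k, l) = (u + v, u - v)\<close> and \<open>(k, l) = (1 - u - v, v - u)\<close> parametrise the pairs
  with even and with odd sum.  Since \<open>a * b = c * d\<close>, the mixed terms \<open>u * v\<close> in the exponents cancel
  and each part factors.  The signs in the second substitution make the two series come out
  in exactly the stated form, without interchanging or shifting arguments afterwards.
\<close>

lemma theta_product:
  assumes "a \<noteq> 0" "b \<noteq> 0" "c \<noteq> 0" "d \<noteq> 0" and eq: "a * b = c * d" and small: "norm (a * b) < 1"
  shows "ramanujan_f a b * ramanujan_f c d =
    ramanujan_f (a * c) (b * d) * ramanujan_f (a * d) (b * c) +
    a * (ramanujan_f (b / c) (a * c\<^sup>2 * d) * ramanujan_f (b / d) (a * c * d\<^sup>2))"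
proof -
  let ?T = theta_term
  obtain \<alpha> \<beta> \<gamma> where a: "a = exp \<alpha>" and b: "b = exp \<beta>" and c: "c = exp \<gamma>"
    using assms(1-3) by (metis exp_Ln)
  have d: "d = exp (\<alpha> + \<beta> - \<gamma>)"
    using eq assms(3) by (simp add: a b c exp_add exp_diff field_simps)
  have args: "a * c = exp (\<alpha> + \<gamma>)" "b * d = exp (\<alpha> + 2 * \<beta> - \<gamma>)"
    "a * d = exp (2 * \<alpha> + \<beta> - \<gamma>)" "b * c = exp (\<beta> + \<gamma>)" "b / c = exp (\<beta> - \<gamma>)"
    "a * c\<^sup>2 * d = exp (2 * \<alpha> + \<beta> + \<gamma>)" "b / d = exp (\<gamma> - \<alpha>)"
    "a * c * d\<^sup>2 = exp (3 * \<alpha> + 2 * \<beta> - \<gamma>)"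
    unfolding a b c d exp_double [symmetric]
    by (simp_all flip: exp_add exp_diff add: algebra_simps)
  have small2: "norm ((a * b)\<^sup>2) < 1"
    using small by (simp add: norm_power power_less_one_iff)
  have prods: "(a * c) * (b * d) = (a * b)\<^sup>2" "(a * d) * (b * c) = (a * b)\<^sup>2"
    "(b / c) * (a * c\<^sup>2 * d) = (a * b)\<^sup>2" "(b / d) * (a * c * d\<^sup>2) = (a * b)\<^sup>2"
    using assms(3,4) eq by (simp_all add: power2_eq_square field_simps)
  have sm: "norm (c * d) < 1" "norm ((a * c) * (b * d)) < 1" "norm ((a * d) * (b * c)) < 1"
    "norm ((b / c) * (a * c\<^sup>2 * d)) < 1" "norm ((b / d) * (a * c * d\<^sup>2)) < 1"
    unfolding prods using small small2 eq by simp_all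
  let ?E = "{(k, l). even (k + l :: int)}"
  have even: "bij_betw (\<lambda>(u, v). (u + v, u - v)) UNIV ?E"
    by (rule bij_betwI [of _ _ _ "\<lambda>(k, l). ((k + l) div 2, (k - l) div 2)"];
        clarsimp; presburger)
  have odd: "bij_betw (\<lambda>(u, v). (1 - u - v, v - u)) UNIV (- ?E)"
    by (rule bij_betwI [of _ _ _ "\<lambda>(k, l). ((1 - k - l) div 2, (1 - k + l) div 2)"];
        clarsimp; presburger)
  have even_term: "?T a b (u + v) * ?T c d (u - v) = ?T (a * c) (b * d) u * ?T (a * d) (b * c) v"
    for u v
    unfolding args unfolding a b c d theta_term_exp exp_add [symmetric] of_int_add of_int_diff
    by (rule arg_cong [where f = exp]) (simp add: field_simps power2_eq_square)
  have odd_term: "?T a b (1 - u - v) * ?T c d (v - u) =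
      a * (?T (b / c) (a * c\<^sup>2 * d) u * ?T (b / d) (a * c * d\<^sup>2) v)" for u v
    \<comment> \<open>The argument \<open>a * c * d\<^sup>2\<close> contains \<open>a * c\<close>, so it is rewritten before the short ones.\<close>
    unfolding args(8) unfolding args
    unfolding a b c d theta_term_exp exp_add [symmetric] of_int_add of_int_diff of_int_1
    by (rule arg_cong [where f = exp]) (simp add: field_simps power2_eq_square)
  note abs = theta_term_abs_summable
  have "ramanujan_f a b * ramanujan_f c d = (\<Sum>\<^sub>\<infinity>(k, l)\<in>UNIV. ?T a b k * ?T c d l)"
    unfolding ramanujan_f_theta_term
    by (rule infsum_product [symmetric]) (intro abs small sm)+
  also have "\<dots> = (\<Sum>\<^sub>\<infinity>(u, v)\<in>UNIV. ?T a b (u + v) * ?T c d (u - v)) +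
      (\<Sum>\<^sub>\<infinity>(u, v)\<in>UNIV. ?T a b (1 - u - v) * ?T c d (v - u))"
    using infsum_split_bij [OF summable_on_product [OF abs [OF small] abs [OF sm(1)]] even odd]
    by (simp add: case_prod_unfold)
  also have "\<dots> = (\<Sum>\<^sub>\<infinity>(u, v)\<in>UNIV. ?T (a * c) (b * d) u * ?T (a * d) (b * c) v) +
      a * (\<Sum>\<^sub>\<infinity>(u, v)\<in>UNIV. ?T (b / c) (a * c\<^sup>2 * d) u * ?T (b / d) (a * c * d\<^sup>2) v)"
    unfolding even_term odd_term by (simp add: case_prod_unfold infsum_cmult_right')
  also have "(\<Sum>\<^sub>\<infinity>(u, v)\<in>UNIV. ?T (a * c) (b * d) u * ?T (a * d) (b * c) v) =
      ramanujan_f (a * c) (b * d) * ramanujan_f (a * d) (b * c)"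
    unfolding ramanujan_f_theta_term by (rule infsum_product) (intro abs sm)+
  also have "(\<Sum>\<^sub>\<infinity>(u, v)\<in>UNIV. ?T (b / c) (a * c\<^sup>2 * d) u * ?T (b / d) (a * c * d\<^sup>2) v) =
      ramanujan_f (b / c) (a * c\<^sup>2 * d) * ramanujan_f (b / d) (a * c * d\<^sup>2)"
    unfolding ramanujan_f_theta_term by (rule infsum_product) (intro abs sm)+
  finally show ?thesis .
qed

text \<open>
  The terms with index \<open>2 * u\<close> form the first series, those with index \<open>1 - 2 * u\<close> the second.
\<close>

lemma theta_dissection:
  assumes "a \<noteq> 0" "b \<noteq> 0" and small: "norm (a * b) < 1"
  shows "ramanujan_f a b = ramanujan_f (a ^ 3 * b) (a * b ^ 3) + a * ramanujan_f (b / a) (a ^ 5 * b ^ 3)"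
proof -
  let ?T = theta_term
  obtain \<alpha> \<beta> where a: "a = exp \<alpha>" and b: "b = exp \<beta>"
    using assms(1,2) by (metis exp_Ln)
  have args: "a ^ 3 * b = exp (3 * \<alpha> + \<beta>)" "a * b ^ 3 = exp (\<alpha> + 3 * \<beta>)" "b / a = exp (\<beta> - \<alpha>)"
    "a ^ 5 * b ^ 3 = exp (5 * \<alpha> + 3 * \<beta>)"
    unfolding a b by (simp_all add: exp_add exp_diff exp_of_nat_mult [of 3, simplified]
       exp_of_nat_mult [of 5, simplified])
  have even: "bij_betw (\<lambda>u. 2 * u) UNIV {k :: int. even k}"
    by (rule bij_betwI [of _ _ _ "\<lambda>k. k div 2"]) auto
  have odd: "bij_betw (\<lambda>u. 1 - 2 * u) UNIV (- {k :: int. even k})"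
    by (rule bij_betwI [of _ _ _ "\<lambda>k. (1 - k) div 2"]) auto
  have even_term: "?T a b (2 * u) = ?T (a ^ 3 * b) (a * b ^ 3) u" for u
    unfolding args unfolding a b theta_term_exp
    by (rule arg_cong [where f = exp]) (simp add: field_simps)
  have odd_term: "?T a b (1 - 2 * u) = a * ?T (b / a) (a ^ 5 * b ^ 3) u" for u
    unfolding args unfolding a b theta_term_exp exp_add [symmetric]
    by (rule arg_cong [where f = exp]) (simp add: field_simps)
  show ?thesis
    using infsum_split_bij [OF theta_term_summable [OF small] even odd]
    unfolding ramanujan_f_theta_term even_term odd_term by (simp add: infsum_cmult_right')
qed

section \<open>Infinite products\<close>

lemma convergent_prod_qpoch:
  fixes l q :: complex
  assumes "norm q < 1"
  shows "convergent_prod (\<lambda>j. 1 - l * q ^ j)"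
proof -
  have "summable (\<lambda>j. norm (- (l * q ^ j)))"
    using assms by (simp add: norm_mult norm_power summable_mult summable_geometric)
  then have "abs_convergent_prod (\<lambda>j. 1 - l * q ^ j)"
    by (subst abs_convergent_prod_conv_summable) simp
  then show ?thesis by (rule abs_convergent_prod_imp_convergent_prod)
qed

lemma qpoch_inf_LIMSEQ:
  assumes "norm q < 1"
  shows "(\<lambda>n. \<Prod>j<n. 1 - l * q ^ j) \<longlonglongrightarrow> qpoch_inf l q"
proof -
  have "(\<lambda>n. \<Prod>j<Suc n. 1 - l * q ^ j) \<longlonglongrightarrow> qpoch_inf l q"
    using convergent_prod_LIMSEQ [OF convergent_prod_qpoch [OF assms, of l]]
    by (simp only: lessThan_Suc_atMost qpoch_inf_def)
  then show ?thesis by (rule LIMSEQ_imp_Suc)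
qed

lemma mult_power_neq_1:
  fixes l q :: complex
  assumes "norm q < 1" "norm l < 1"
  shows "1 - l * q ^ j \<noteq> 0"
proof -
  have "norm (l * q ^ j) \<le> norm l * 1"
    unfolding norm_mult norm_power using assms by (intro mult_left_mono power_le_one) auto
  with assms have "norm (l * q ^ j) < 1" by simp
  then show ?thesis by auto
qed

lemma qpoch_inf_nonzero:
  assumes "norm q < 1" "norm l < 1"
  shows "qpoch_inf l q \<noteq> 0"
  unfolding qpoch_inf_def
  using assms by (intro prodinf_nonzero convergent_prod_qpoch mult_power_neq_1)

text \<open>
  The factors with exponents congruent to \<open>i\<close> modulo \<open>m\<close> form the \<open>i\<close>-th product on the right.
\<close>

lemma qpoch_inf_split:
  assumes q: "norm q < 1" and m: "m > 0"
  shows "qpoch_inf l q = (\<Prod>i<m. qpoch_inf (l * q ^ i) (q ^ m))"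
proof -
  have "norm (q ^ m) < 1"
    using q m by (simp add: norm_power power_less_one_iff)
  then have "(\<lambda>n. \<Prod>i<m. \<Prod>j<n. 1 - l * q ^ i * (q ^ m) ^ j) \<longlonglongrightarrow>
      (\<Prod>i<m. qpoch_inf (l * q ^ i) (q ^ m))"
    by (intro tendsto_prod qpoch_inf_LIMSEQ)
  moreover have "(\<Prod>i<m. \<Prod>j<n. 1 - l * q ^ i * (q ^ m) ^ j) = (\<Prod>k<n * m. 1 - l * q ^ k)" for n
  proof -
    have "(\<Prod>k<n * m. 1 - l * q ^ k) = (\<Prod>j<n. \<Prod>k\<in>{j * m..<j * m + m}. 1 - l * q ^ k)"
      by (rule prod.nat_group [symmetric])
    also have "\<dots> = (\<Prod>j<n. \<Prod>i<m. 1 - l * q ^ (i + j * m))"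
    proof (rule prod.cong [OF refl])
      fix j
      show "(\<Prod>k\<in>{j * m..<j * m + m}. 1 - l * q ^ k) = (\<Prod>i<m. 1 - l * q ^ (i + j * m))"
        by (rule prod.reindex_bij_witness [of _ "\<lambda>i. i + j * m" "\<lambda>k. k - j * m"]) auto
    qed
    finally show ?thesis
      by (subst prod.swap) (simp add: power_add power_mult [symmetric] mult_ac)
  qed
  moreover have "(\<lambda>n. \<Prod>k<n * m. 1 - l * q ^ k) \<longlonglongrightarrow> qpoch_inf l q"
    using LIMSEQ_subseq_LIMSEQ [OF qpoch_inf_LIMSEQ [OF q], of "\<lambda>n. n * m" l] m
    by (simp add: strict_mono_def o_def)
  ultimately show ?thesis
    using LIMSEQ_unique by simp
qed

section \<open>Jacobi's triple product\<close>

text \<open>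
  An absolutely convergent sum is an integral for the counting measure, so this is Lebesgue's
  theorem.
\<close>

lemma infsum_dominated_convergence:
  fixes F :: "nat \<Rightarrow> 'a \<Rightarrow> complex"
  assumes lim: "\<And>x. (\<lambda>n. F n x) \<longlonglongrightarrow> G x"
    and bound: "\<And>n x. norm (F n x) \<le> w x"
    and w: "w summable_on UNIV"
  shows "(\<lambda>n. infsum (F n) UNIV) \<longlonglongrightarrow> infsum G UNIV"
proof -
  have w_nonneg: "0 \<le> w x" for x
    using bound [of 0 x] norm_ge_zero order_trans by blast
  have w_int: "integrable (count_space UNIV) w"
    using w w_nonneg abs_summable_equivalent [of w UNIV]
    by (simp add: Infinite_Set_Sum.abs_summable_on_def)
  have *: "(\<lambda>n. integral\<^sup>L (count_space UNIV) (F n)) \<longlonglongrightarrow> integral\<^sup>L (count_space UNIV) G"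
    "integrable (count_space UNIV) G" "\<And>n. integrable (count_space UNIV) (F n)"
    using integral_dominated_convergence [of G "count_space UNIV" F w]
      integrable_dominated_convergence [of G "count_space UNIV" F w]
      integrable_dominated_convergence2 [of G "count_space UNIV" F w] w_int lim bound
    by auto
  then show ?thesis
    by (simp add: infsetsum_infsum [symmetric] infsetsum_def Infinite_Set_Sum.abs_summable_on_def)
qed

text \<open>
  The finite \<open>q\<close>-Pochhammer symbol \<open>(p; p)\<^sub>n\<close>.
\<close>

definition qfact :: "complex \<Rightarrow> nat \<Rightarrow> complex" where
  "qfact p n = (\<Prod>j<n. 1 - p * p ^ j)"

text \<open>
  The extension by 0 to negative integers makes the recurrence below hold for all integers, the
  factor \<open>1 - p powi 0 = 0\<close> accounting for the step from \<open>-1\<close> to \<open>0\<close>.  The \<open>q\<close>-binomial coefficients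
  built from it vanish outside their range, and no boundary terms have to be treated separately.
\<close>

definition inv_qfact :: "complex \<Rightarrow> int \<Rightarrow> complex" where
  "inv_qfact p m = (if m < 0 then 0 else 1 / qfact p (nat m))"

lemma qfact_nonzero: "norm p < 1 \<Longrightarrow> qfact p n \<noteq> 0"
  unfolding qfact_def using mult_power_neq_1 [of p p] by simp

lemma inv_qfact_rec:
  assumes "norm p < 1"
  shows "inv_qfact p m = (1 - p powi (m + 1)) * inv_qfact p (m + 1)"
proof (cases "m < 0")
  case True
  then show ?thesis by (cases "m = -1") (auto simp: inv_qfact_def)
next
  case False
  then have "nat (m + 1) = Suc (nat m)" by simp
  moreover have "p powi (m + 1) = p * p ^ nat m"
    using False by (simp add: power_int_def nat_add_distrib)
  ultimately show ?thesis
    using False qfact_nonzero [OF assms, of "nat m"] mult_power_neq_1 [OF assms assms, of "nat m"]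
    by (simp add: inv_qfact_def qfact_def)
qed

lemma theta_term_rec:
  assumes "a \<noteq> 0" "b \<noteq> 0"
  shows "theta_term a b (k + 1) = theta_term a b k * (a * (a * b) powi k)"
proof -
  obtain \<alpha> \<beta> where a: "a = exp \<alpha>" and b: "b = exp \<beta>"
    using assms by (metis exp_Ln)
  have ab: "(a * b) powi k = exp (of_int k * (\<alpha> + \<beta>))"
    unfolding a b exp_add [symmetric] by (simp only: exp_power_int mult.commute)
  show ?thesis
    unfolding ab unfolding a b theta_term_exp exp_add [symmetric]
    by (rule arg_cong [where f = exp]) (simp add: field_simps)
qed

text \<open>
  The finite form of the triple product.  The coefficient of the \<open>k\<close>-th theta term is the
  \<open>q\<close>-binomial coefficient of \<open>2 * n\<close> over \<open>n + k\<close>, for the base \<open>a * b\<close>.  With \<open>p = a * b\<close>, passing from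
  \<open>n\<close> to \<open>n + 1\<close> multiplies the product by \<open>1 + p ^ (2 * n + 1) + a * p ^ n + b * p ^ n\<close>.  Multiplying
  a theta term by \<open>a\<close> or \<open>b\<close> gives the next or the previous term up to a power of \<open>p\<close>, so the induction
  step reduces to a three-term recurrence for the coefficients.  The series has only finitely
  many nonzero terms, but summing over all integers allows the index to be shifted freely.
\<close>

lemma finite_triple_product:
  assumes "a \<noteq> 0" "b \<noteq> 0" and small: "norm (a * b) < 1"
  shows "((\<lambda>k. theta_term a b k *
      (qfact (a * b) (2 * n) * inv_qfact (a * b) (int n + k) * inv_qfact (a * b) (int n - k)))
    has_sum (\<Prod>j<n. (1 + a * (a * b) ^ j) * (1 + b * (a * b) ^ j))) UNIV"
proof (induction n)
  case 0
  have "inv_qfact (a * b) k * inv_qfact (a * b) (- k) = 0" if "k \<noteq> 0" for k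
    using that by (auto simp: inv_qfact_def)
  then show ?case
    by (intro has_sum_finite_neutralI [of "{0}"])
      (auto simp: theta_term_def inv_qfact_def qfact_def)
next
  case (Suc n)
  define p where "p = a * b"
  have p0: "p \<noteq> 0" and p1: "norm p < 1" using assms by (auto simp: p_def)
  define c where "c n k = qfact p (2 * n) * inv_qfact p (int n + k) * inv_qfact p (int n - k)"
    for n and k :: int
  let ?T = "theta_term a b"
  let ?P = "\<Prod>j<n. (1 + a * p ^ j) * (1 + b * p ^ j)"
  have IH: "((\<lambda>k. ?T k * c n k) has_sum ?P) UNIV"
    using Suc by (simp add: c_def p_def)
  have down: "((\<lambda>k. ?T (k - 1) * c n (k - 1)) has_sum ?P) UNIV"
    by (rule has_sum_reindex_bij_witness [THEN iffD2, OF _ _ _ _ _ _ IH, of _ "\<lambda>k. k + 1" "\<lambda>k. k - 1"]) auto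
  have up: "((\<lambda>k. ?T (k + 1) * c n (k + 1)) has_sum ?P) UNIV"
    by (rule has_sum_reindex_bij_witness [THEN iffD2, OF _ _ _ _ _ _ IH, of _ "\<lambda>k. k - 1" "\<lambda>k. k + 1"]) auto
  have "((\<lambda>k. (1 + p ^ (2 * n + 1)) * (?T k * c n k) + a * p ^ n * (?T (k - 1) * c n (k - 1)) +
      b * p ^ n * (?T (k + 1) * c n (k + 1))) has_sum
      ((1 + p ^ (2 * n + 1)) * ?P + a * p ^ n * ?P + b * p ^ n * ?P)) UNIV"
    by (intro has_sum_add has_sum_cmult_right IH down up)
  also have "(1 + p ^ (2 * n + 1)) * ?P + a * p ^ n * ?P + b * p ^ n * ?P =
      ?P * ((1 + a * p ^ n) * (1 + b * p ^ n))"
  proof -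
    have "p ^ (2 * n + 1) = a * b * (p ^ n * p ^ n)"
      by (simp add: p_def [symmetric] power_add mult_2)
    then show ?thesis by (simp only:) (simp add: algebra_simps)
  qed
  also have "?P * ((1 + a * p ^ n) * (1 + b * p ^ n)) = (\<Prod>j<Suc n. (1 + a * p ^ j) * (1 + b * p ^ j))"
    by simp
  also have "(\<lambda>k. (1 + p ^ (2 * n + 1)) * (?T k * c n k) + a * p ^ n * (?T (k - 1) * c n (k - 1)) +
      b * p ^ n * (?T (k + 1) * c n (k + 1))) = (\<lambda>k. ?T k * c (Suc n) k)"
  proof
    fix k :: int
    \<comment> \<open>In terms of these quantities the recurrence is a polynomial identity in \<open>p\<close>, \<open>u\<close> and \<open>v\<close>.\<close>
    define u v where "u = p powi (int n + k)" and "v = p powi (int n - k)"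
    define R Q where "R = inv_qfact p (int n + k + 1)" and "Q = inv_qfact p (int n - k + 1)"
    have uv: "p ^ (2 * n) = u * v"
    proof -
      have "u * v = p powi (int n + k + (int n - k))"
        using p0 by (subst power_int_add) (simp_all add: u_def v_def)
      also have "int n + k + (int n - k) = int (2 * n)" by simp
      finally show ?thesis by (simp only: power_int_of_nat)
    qed
    have pu: "p powi (int n + k + 1) = p * u" and pv: "p powi (int n - k + 1) = p * v"
      using p0 by (simp_all add: u_def v_def power_int_add)
    have R1: "inv_qfact p (int n + k) = (1 - p * u) * R"
      using inv_qfact_rec [OF p1, of "int n + k"] by (simp add: R_def pu)
    have R2: "inv_qfact p (int n + (k - 1)) = (1 - u) * ((1 - p * u) * R)"
      using inv_qfact_rec [OF p1, of "int n + k - 1"] by (simp add: u_def R1 add_diff_eq)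
    have Q1: "inv_qfact p (int n - k) = (1 - p * v) * Q"
      using inv_qfact_rec [OF p1, of "int n - k"] by (simp add: Q_def pv)
    have Q2: "inv_qfact p (int n - (k + 1)) = (1 - v) * ((1 - p * v) * Q)"
      using inv_qfact_rec [OF p1, of "int n - k - 1"] by (simp add: v_def Q1 diff_diff_eq)
    have D: "qfact p (2 * Suc n) = qfact p (2 * n) * ((1 - p * (u * v)) * (1 - p * p * (u * v)))"
      by (simp add: qfact_def uv [symmetric])
    have R0: "inv_qfact p (int n + (k + 1)) = R" "inv_qfact p (int (Suc n) + k) = R"
      and Q0: "inv_qfact p (int n - (k - 1)) = Q" "inv_qfact p (int (Suc n) - k) = Q"
      by (simp_all add: R_def Q_def algebra_simps)
    have c0: "c n k = qfact p (2 * n) * R * Q * ((1 - p * u) * (1 - p * v))"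
      unfolding c_def R1 Q1 by (simp only: mult_ac)
    have c_minus: "c n (k - 1) = qfact p (2 * n) * R * Q * ((1 - u) * (1 - p * u))"
      unfolding c_def R2 Q0 by (simp only: mult_ac)
    have c_plus: "c n (k + 1) = qfact p (2 * n) * R * Q * ((1 - v) * (1 - p * v))"
      unfolding c_def R0 Q2 by (simp only: mult_ac)
    have c_Suc: "c (Suc n) k = qfact p (2 * n) * R * Q * ((1 - p * (u * v)) * (1 - p * p * (u * v)))"
      unfolding c_def D R0 Q0 by (simp only: mult_ac)
    have T_minus: "a * p ^ n * ?T (k - 1) = ?T k * (p * v)"
    proof -
      have "?T k = ?T (k - 1) * (a * p powi (k - 1))"
        using theta_term_rec [OF assms(1,2), of "k - 1"] by (simp add: p_def)
      moreover have "p powi (k - 1) * (p * v) = p ^ n"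
      proof -
        have "p powi (k - 1) * (p * v) = p powi ((k - 1) + (int n - k + 1))"
          using p0 by (subst power_int_add) (auto simp: pv)
        then show ?thesis by simp
      qed
      ultimately show ?thesis by (simp add: mult_ac)
    qed
    have T_plus: "b * p ^ n * ?T (k + 1) = ?T k * (p * u)"
    proof -
      have "?T (k + 1) = ?T k * (a * p powi k)"
        using theta_term_rec [OF assms(1,2), of k] by (simp add: p_def)
      moreover have "p ^ n * p powi k = u"
        using p0 by (simp add: u_def power_int_add)
      ultimately show ?thesis by (simp add: p_def mult_ac)
    qed
    have "(1 + p ^ (2 * n + 1)) * (?T k * c n k) + a * p ^ n * (?T (k - 1) * c n (k - 1)) +
        b * p ^ n * (?T (k + 1) * c n (k + 1)) =
        (1 + p * (u * v)) * (?T k * c n k) + (a * p ^ n * ?T (k - 1)) * c n (k - 1) +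
        (b * p ^ n * ?T (k + 1)) * c n (k + 1)"
      unfolding power_add power_one_right uv by (simp only: mult_ac)
    also have "\<dots> = ?T k * c (Suc n) k"
      unfolding T_minus T_plus c0 c_minus c_plus c_Suc by algebra
    finally show "(1 + p ^ (2 * n + 1)) * (?T k * c n k) + a * p ^ n * (?T (k - 1) * c n (k - 1)) +
        b * p ^ n * (?T (k + 1) * c n (k + 1)) = ?T k * c (Suc n) k" .
  qed
  finally show ?case by (simp add: c_def p_def)
qed

text \<open>
  Both \<open>(p; p)\<^sub>n\<close> and its inverse converge, hence are bounded.  So the coefficients in the finite
  identity are bounded uniformly in \<open>n\<close> and \<open>k\<close>, and each tends to \<open>1 / (p; p)\<^sub>\<infinity>\<close>.
\<close>

theorem jacobi_triple_product:
  assumes "a \<noteq> 0" "b \<noteq> 0" and small: "norm (a * b) < 1"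
  shows "ramanujan_f a b =
    qpoch_inf (- a) (a * b) * qpoch_inf (- b) (a * b) * qpoch_inf (a * b) (a * b)"
proof -
  define p where "p = a * b"
  have p1: "norm p < 1" using small by (simp add: p_def)
  define P where "P = qpoch_inf p p"
  have P0: "P \<noteq> 0" unfolding P_def using p1 by (intro qpoch_inf_nonzero)
  have lim: "qfact p \<longlonglongrightarrow> P"
    unfolding qfact_def [abs_def] P_def by (rule qpoch_inf_LIMSEQ [OF p1])
  have inv_lim: "(\<lambda>n. 1 / qfact p n) \<longlonglongrightarrow> 1 / P"
    by (intro tendsto_intros lim P0)
  obtain B where B: "\<And>n. norm (qfact p n) \<le> B"
    using convergent_imp_Bseq [of "qfact p"] lim by (auto simp: convergent_def Bseq_def)
  obtain C where C0: "C > 0" and C: "\<And>n. norm (1 / qfact p n) \<le> C"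
    using convergent_imp_Bseq [of "\<lambda>n. 1 / qfact p n"] inv_lim by (auto simp: convergent_def Bseq_def)
  have inv_C: "norm (inv_qfact p m) \<le> C" for m
    using C C0 by (auto simp: inv_qfact_def less_imp_le)
  have inv_qfact_lim: "(\<lambda>n. inv_qfact p (int n + k)) \<longlonglongrightarrow> 1 / P" for k
  proof -
    have "(\<lambda>n. 1 / qfact p (nat (int n + k))) \<longlonglongrightarrow> 1 / P"
    proof (rule filterlim_compose [OF inv_lim])
      show "filterlim (\<lambda>n. nat (int n + k)) sequentially sequentially"
        unfolding filterlim_at_top eventually_sequentially
      proof
        fix Z
        show "\<exists>N. \<forall>n\<ge>N. Z \<le> nat (int n + k)"
          by (rule exI [of _ "nat (int Z - k)"]) auto
      qed
    qed
    moreover have "eventually (\<lambda>n. 1 / qfact p (nat (int n + k)) = inv_qfact p (int n + k)) sequentially"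
      using eventually_ge_at_top [of "nat (- k)"]
      by eventually_elim (auto simp: inv_qfact_def)
    ultimately show ?thesis by (rule Lim_transform_eventually)
  qed
  define F where "F n k = theta_term a b k *
      (qfact p (2 * n) * inv_qfact p (int n + k) * inv_qfact p (int n - k))" for n k
  have F_sum: "infsum (F n) UNIV = (\<Prod>j<n. (1 + a * p ^ j) * (1 + b * p ^ j))" for n
    using finite_triple_product [OF assms, of n] unfolding F_def p_def by (rule infsumI)
  have "(\<lambda>n. infsum (F n) UNIV) \<longlonglongrightarrow> infsum (\<lambda>k. theta_term a b k * (P * (1 / P) * (1 / P))) UNIV"
  proof (rule infsum_dominated_convergence [where w = "\<lambda>k. norm (theta_term a b k) * (B * C * C)"])
    fix k
    have "(\<lambda>n. qfact p (2 * n)) \<longlonglongrightarrow> P"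
      using LIMSEQ_subseq_LIMSEQ [OF lim, of "\<lambda>n. 2 * n"] by (simp add: strict_mono_def o_def)
    then show "(\<lambda>n. F n k) \<longlonglongrightarrow> theta_term a b k * (P * (1 / P) * (1 / P))"
      unfolding F_def using inv_qfact_lim [of k] inv_qfact_lim [of "- k"]
      by (intro tendsto_mult tendsto_const) simp_all
  next
    fix n k
    have "0 \<le> B" using B [of 0] norm_ge_zero order_trans by blast
    then show "norm (F n k) \<le> norm (theta_term a b k) * (B * C * C)"
      unfolding F_def norm_mult
      using C0 by (intro mult_left_mono mult_mono B inv_C) auto
  next
    show "(\<lambda>k. norm (theta_term a b k) * (B * C * C)) summable_on UNIV"
      by (intro summable_on_cmult_left theta_term_abs_summable small)
  qed
  also have "infsum (\<lambda>k. theta_term a b k * (P * (1 / P) * (1 / P))) UNIV = ramanujan_f a b / P"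
    unfolding ramanujan_f_theta_term by (subst infsum_cmult_left') (simp add: P0)
  finally have "(\<lambda>n. \<Prod>j<n. (1 + a * p ^ j) * (1 + b * p ^ j)) \<longlonglongrightarrow> ramanujan_f a b / P"
    unfolding F_sum .
  moreover have "(\<lambda>n. \<Prod>j<n. (1 + a * p ^ j) * (1 + b * p ^ j)) \<longlonglongrightarrow>
      qpoch_inf (- a) p * qpoch_inf (- b) p"
    using tendsto_mult [OF qpoch_inf_LIMSEQ [OF p1, of "- a"] qpoch_inf_LIMSEQ [OF p1, of "- b"]]
    by (simp add: prod.distrib)
  ultimately have "ramanujan_f a b / P = qpoch_inf (- a) p * qpoch_inf (- b) p"
    by (rule LIMSEQ_unique)
  then show ?thesis using P0 by (simp add: P_def p_def field_simps)
qed

corollary ramanujan_f_nonzero: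
  assumes "a \<noteq> 0" "b \<noteq> 0" "norm a < 1" "norm b < 1"
  shows "ramanujan_f a b \<noteq> 0"
proof -
  have "norm (a * b) < 1"
    using assms by (metis norm_mult norm_ge_zero mult_strict_mono' mult_1)
  then show ?thesis
    using assms by (simp add: jacobi_triple_product qpoch_inf_nonzero)
qed

section \<open>The identities for the quotients\<close>

text \<open>
  This is \<open>theta_product\<close> for the factors \<open>f(-e x, -e c\<^sup>2/x)\<close> and \<open>\<phi>(e c) = f(e c, e c)\<close>.  The two
  arguments of \<open>\<phi>\<close> being equal, each product on the right becomes a square.
\<close>

lemma theta_square_difference:
  assumes "c \<noteq> 0" "x \<noteq> 0" and e: "e \<in> {1, -1}" and "norm c < 1"
  shows "(ramanujan_f (- (c * x)) (- (c ^ 3 / x)))\<^sup>2 - e * x * (ramanujan_f (- (c / x)) (- (c ^ 3 * x)))\<^sup>2 =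
    ramanujan_f (- e * x) (- e * (c\<^sup>2 / x)) * ramanujan_phi (e * c)"
proof -
  have e2: "e * e = 1" "e \<noteq> 0" using e by auto
  have prod: "(- e * x) * (- e * (c\<^sup>2 / x)) = (e * c) * (e * c)"
    using assms(2) by (simp add: power2_eq_square)
  have small: "norm ((- e * x) * (- e * (c\<^sup>2 / x))) < 1"
  proof -
    have "(e * c) * (e * c) = c\<^sup>2"
      using e by (auto simp: power2_eq_square)
    then show ?thesis
      unfolding prod using assms(4) by (simp add: norm_power power_less_one_iff)
  qed
  have args: "- e * x * (e * c) = - (c * x)" "- e * (c\<^sup>2 / x) * (e * c) = - (c ^ 3 / x)"
    "- e * (c\<^sup>2 / x) / (e * c) = - (c / x)" "- e * x * (e * c)\<^sup>2 * (e * c) = - (c ^ 3 * x)"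
    "- e * x * (e * c) * (e * c)\<^sup>2 = - (c ^ 3 * x)"
    using e assms(1,2) by (auto simp: power2_eq_square power3_eq_cube)
  show ?thesis
    using theta_product [OF _ _ _ _ prod small] e2(2) assms(1,2)
    unfolding args(4,5) unfolding args ramanujan_phi_def by (simp add: power2_eq_square)
qed

text \<open>
  Here \<open>theta_product\<close> has the common factor \<open>f(c\<^sup>2, c\<^sup>6) = \<psi>(c\<^sup>2)\<close> in both terms, and the cofactor is
  the dissection of \<open>f(-c x, -c/x)\<close>.
\<close>

lemma theta_product_psi:
  assumes "c \<noteq> 0" "x \<noteq> 0" and "norm c < 1"
  shows "ramanujan_f (- (c * x)) (- (c ^ 3 / x)) * ramanujan_f (- (c / x)) (- (c ^ 3 * x)) =
    ramanujan_f (- (c / x)) (- (c * x)) * ramanujan_psi (c\<^sup>2)"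
proof -
  have prod: "(- (c * x)) * (- (c ^ 3 / x)) = (- (c / x)) * (- (c ^ 3 * x))"
    using assms(2) by (simp add: field_simps)
  have "(- (c * x)) * (- (c ^ 3 / x)) = c ^ 4"
    using assms(2) by (simp add: field_simps eval_nat_numeral)
  then have small: "norm ((- (c * x)) * (- (c ^ 3 / x))) < 1"
    using assms(3) by (simp add: norm_power power_less_one_iff)
  have "(- (c * x)) * (- (c / x)) = c\<^sup>2"
    using assms(2) by (simp add: power2_eq_square)
  then have small': "norm ((- (c * x)) * (- (c / x))) < 1"
    using assms(3) by (simp add: norm_power power_less_one_iff)
  have args: "- (c * x) * - (c / x) = c\<^sup>2" "- (c ^ 3 / x) * - (c ^ 3 * x) = (c\<^sup>2) ^ 3"
    "- (c * x) * - (c ^ 3 * x) = c ^ 4 * x\<^sup>2" "- (c ^ 3 / x) * - (c / x) = c ^ 4 / x\<^sup>2"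
    "- (c ^ 3 / x) / - (c / x) = c\<^sup>2" "- (c * x) * (- (c / x))\<^sup>2 * - (c ^ 3 * x) = (c\<^sup>2) ^ 3"
    "- (c ^ 3 / x) / - (c ^ 3 * x) = 1 / x\<^sup>2" "- (c * x) * - (c / x) * (- (c ^ 3 * x))\<^sup>2 = c ^ 8 * x\<^sup>2"
    "(- (c * x)) ^ 3 * - (c / x) = c ^ 4 * x\<^sup>2" "- (c * x) * (- (c / x)) ^ 3 = c ^ 4 / x\<^sup>2"
    "- (c / x) / - (c * x) = 1 / x\<^sup>2" "(- (c * x)) ^ 5 * (- (c / x)) ^ 3 = c ^ 8 * x\<^sup>2"
    using assms(1,2) by (simp_all add: field_simps eval_nat_numeral)
  have "ramanujan_f (- (c * x)) (- (c ^ 3 / x)) * ramanujan_f (- (c / x)) (- (c ^ 3 * x)) =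
      ramanujan_f (c\<^sup>2) ((c\<^sup>2) ^ 3) * ramanujan_f (c ^ 4 * x\<^sup>2) (c ^ 4 / x\<^sup>2) +
      - (c * x) * (ramanujan_f (c\<^sup>2) ((c\<^sup>2) ^ 3) * ramanujan_f (1 / x\<^sup>2) (c ^ 8 * x\<^sup>2))"
    using theta_product [OF _ _ _ _ prod small] assms(1,2) unfolding args(6,8) unfolding args by simp
  moreover have "ramanujan_f (- (c * x)) (- (c / x)) =
      ramanujan_f (c ^ 4 * x\<^sup>2) (c ^ 4 / x\<^sup>2) + - (c * x) * ramanujan_f (1 / x\<^sup>2) (c ^ 8 * x\<^sup>2)"
    using theta_dissection [OF _ _ small'] assms(1,2) unfolding args by simp
  ultimately show ?thesis
    unfolding ramanujan_psi_def ramanujan_f_commute [of "- (c / x)" "- (c * x)"]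
    by (simp only: distrib_left mult_ac)
qed

text \<open>
  The common form of (i)--(iv), for \<open>c = s ^ 9\<close> and \<open>x = s ^ k\<close>: the bound on \<open>k\<close> keeps the
  exponents in the denominators positive, so that the theta functions there do not vanish.
\<close>

lemma theta_quotient_identity:
  fixes s e :: complex
  assumes s0: "s \<noteq> 0" and s1: "norm s < 1" and e: "e \<in> {1, -1}" and k: "k < 9"
  shows "1 / (ramanujan_f (- (s ^ (9 - k))) (- (s ^ (27 + k))) /
              ramanujan_f (- (s ^ (9 + k))) (- (s ^ (27 - k)))) -
      e * s ^ k * (ramanujan_f (- (s ^ (9 - k))) (- (s ^ (27 + k))) /
              ramanujan_f (- (s ^ (9 + k))) (- (s ^ (27 - k)))) =
    ramanujan_f (- e * s ^ k) (- e * s ^ (18 - k)) * ramanujan_phi (e * s ^ 9) /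
      (ramanujan_f (- (s ^ (9 - k))) (- (s ^ (9 + k))) * ramanujan_psi (s ^ 18))"
proof -
  have nz: "ramanujan_f (- (s ^ m)) (- (s ^ n)) \<noteq> 0" if "m > 0" "n > 0" for m n
    using that s0 s1 by (intro ramanujan_f_nonzero) (auto simp: norm_power power_less_one_iff)
  have psi: "ramanujan_psi (s ^ 18) \<noteq> 0"
    unfolding ramanujan_psi_def using s0 s1
    by (intro ramanujan_f_nonzero) (auto simp: norm_power power_less_one_iff power_mult [symmetric])
  have c: "s ^ 9 \<noteq> 0" "s ^ k \<noteq> 0" "norm (s ^ 9) < 1"
    using s0 s1 by (auto simp: norm_power power_less_one_iff)
  have args: "s ^ 9 * s ^ k = s ^ (9 + k)" "s ^ 9 / s ^ k = s ^ (9 - k)"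
    "(s ^ 9) ^ 3 * s ^ k = s ^ (27 + k)" "(s ^ 9) ^ 3 / s ^ k = s ^ (27 - k)"
    "(s ^ 9)\<^sup>2 / s ^ k = s ^ (18 - k)" "(s ^ 9)\<^sup>2 = s ^ 18"
    using s0 k by (simp_all add: power_add power_mult [symmetric] power_diff)
  define F G where "F = ramanujan_f (- (s ^ (9 + k))) (- (s ^ (27 - k)))"
    and "G = ramanujan_f (- (s ^ (9 - k))) (- (s ^ (27 + k)))"
  have FG: "F \<noteq> 0" "G \<noteq> 0"
    unfolding F_def G_def
    using k nz [of "9 + k" "27 - k"] nz [of "9 - k" "27 + k"] by simp_all
  have sq: "F\<^sup>2 - e * s ^ k * G\<^sup>2 = ramanujan_f (- e * s ^ k) (- e * s ^ (18 - k)) * ramanujan_phi (e * s ^ 9)"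
    using theta_square_difference [OF c(1,2) e c(3)] unfolding args(1-5) F_def G_def .
  have pr: "F * G = ramanujan_f (- (s ^ (9 - k))) (- (s ^ (9 + k))) * ramanujan_psi (s ^ 18)"
    using theta_product_psi [OF c] unfolding args F_def G_def .
  have "1 / (G / F) - e * s ^ k * (G / F) = (F\<^sup>2 - e * s ^ k * G\<^sup>2) / (F * G)"
    using FG by (simp add: field_simps power2_eq_square)
  then show ?thesis unfolding sq pr unfolding F_def G_def .
qed

lemma ramanujan_f_0_0: "ramanujan_f 0 0 = 1"
proof -
  have "theta_term 0 0 k = 0" if "k \<noteq> 0" for k
  proof (cases "k > 0")
    case True
    then have "1 * 2 \<le> k * (k + 1)" by (intro mult_mono) auto
    then have "1 \<le> k * (k + 1) div 2" by linarith
    then have "nat (k * (k + 1) div 2) \<noteq> 0" by linarith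
    then show ?thesis by (simp add: theta_term_def)
  next
    case False
    with that have "1 * 2 \<le> (- k) * (1 - k)" by (intro mult_mono) auto
    then have "1 * 2 \<le> k * (k - 1)" by (simp add: algebra_simps)
    then have "1 \<le> k * (k - 1) div 2" by linarith
    then have "nat (k * (k - 1) div 2) \<noteq> 0" by linarith
    then show ?thesis by (simp add: theta_term_def)
  qed
  then have "(theta_term 0 0 has_sum 1) UNIV"
    by (intro has_sum_finite_neutralI [of "{0}"]) (auto simp: theta_term_def)
  then show ?thesis
    unfolding ramanujan_f_theta_term by (rule infsumI)
qed

text \<open>
  The exponents on the left are the positive integers prime to 3; the right-hand side sorts them by
  their residue modulo 9.  The pairs \<open>(4, 5)\<close>, \<open>(2, 7)\<close>, \<open>(1, 8)\<close> are those of the theta functions in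
  the denominators of (i), (iii) and (iv).
\<close>

lemma qpoch_product_mod_9:
  assumes "norm q < 1"
  shows "qpoch_inf2 q (q\<^sup>2) (q ^ 3) =
    (qpoch_inf (q ^ 4) (q ^ 9) * qpoch_inf (q ^ 5) (q ^ 9)) *
    (qpoch_inf (q ^ 2) (q ^ 9) * qpoch_inf (q ^ 7) (q ^ 9)) *
    (qpoch_inf q (q ^ 9) * qpoch_inf (q ^ 8) (q ^ 9))"
proof -
  have "norm (q ^ 3) < 1"
    using assms by (simp add: norm_power power_less_one_iff)
  then have *: "qpoch_inf l (q ^ 3) =
      qpoch_inf l (q ^ 9) * qpoch_inf (l * q ^ 3) (q ^ 9) * qpoch_inf (l * q ^ 6) (q ^ 9)" for l
  proof -
    have "{..<3} = {0, 1, 2 :: nat}" by auto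
    then show ?thesis
      using qpoch_inf_split [of "q ^ 3" 3 l] \<open>norm (q ^ 3) < 1\<close>
      by (simp flip: power_mult)
  qed
  have "q * q ^ 3 = q ^ 4" "q * q ^ 6 = q ^ 7" "q\<^sup>2 * q ^ 3 = q ^ 5" "q\<^sup>2 * q ^ 6 = q ^ 8"
    by (simp_all flip: power_add power_Suc)
  then show ?thesis
    unfolding qpoch_inf2_def * by (simp only: mult_ac)
qed

section \<open>The theorem\<close>

(* s is the chosen square root of q, so that s ^ m stands for q^(m/2);
   e = 1 gives the upper signs and e = -1 the lower signs. *)
theorem theorem3p1:
  fixes q s :: complex
  assumes "norm q < 1" and "s ^ 2 = q"
  shows "(\<forall>e\<in>{1, -1}. 1 / A 1 q - e * s * A 1 q =
           ramanujan_f (- e * s) (- e * s ^ 17) * ramanujan_phi (e * s ^ 9) /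
           (ramanujan_f (- (q ^ 4)) (- (q ^ 5)) * ramanujan_psi (q ^ 9))) \<and>
         (\<forall>e\<in>{1, -1}. 1 / A 2 q - e * s ^ 3 * A 2 q =
           ramanujan_f (- e * s ^ 3) (- e * s ^ 15) * ramanujan_phi (e * s ^ 9) /
           (ramanujan_f (- (q ^ 3)) (- (q ^ 6)) * ramanujan_psi (q ^ 9))) \<and>
         (\<forall>e\<in>{1, -1}. 1 / A 3 q - e * s ^ 5 * A 3 q =
           ramanujan_f (- e * s ^ 5) (- e * s ^ 13) * ramanujan_phi (e * s ^ 9) /
           (ramanujan_f (- (q ^ 2)) (- (q ^ 7)) * ramanujan_psi (q ^ 9))) \<and>
         (\<forall>e\<in>{1, -1}. 1 / A 4 q - e * s ^ 7 * A 4 q =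
           ramanujan_f (- e * s ^ 7) (- e * s ^ 11) * ramanujan_phi (e * s ^ 9) /
           (ramanujan_f (- q) (- (q ^ 8)) * ramanujan_psi (q ^ 9))) \<and>
         (\<Prod>i\<in>{1, 3, 4}. 1 / A i q + s ^ (2 * i - 1) * A i q) =
           ramanujan_phi (- (s ^ 9)) ^ 3 /
           (ramanujan_psi (q ^ 9) ^ 3 * qpoch_inf2 q (q ^ 2) (q ^ 3)) *
           (\<Prod>i\<in>{1, 3, 4}. qpoch_inf2 (- (s ^ (2 * i - 1))) (- (s ^ (18 - (2 * i - 1)))) (q ^ 9))"
proof (cases "q = 0")
  case True
  with assms have "s = 0" by simp
  have "qpoch_inf 0 0 = 1" by (simp add: qpoch_inf_def)
  with True \<open>s = 0\<close> show ?thesis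
    by (simp add: A_def ramanujan_phi_def ramanujan_psi_def qpoch_inf2_def ramanujan_f_0_0)
next
  case False
  with assms have s0: "s \<noteq> 0" by auto
  have s1: "norm s < 1"
    using assms by (auto simp: norm_power power_less_one_iff)
  have q: "q ^ n = s ^ (2 * n)" for n
    using assms(2) by (simp add: power_mult)
  note id = theta_quotient_identity [OF s0 s1]
  have A1: "1 / A 1 q - e * s * A 1 q =
      ramanujan_f (- e * s) (- e * s ^ 17) * ramanujan_phi (e * s ^ 9) /
      (ramanujan_f (- (q ^ 4)) (- (q ^ 5)) * ramanujan_psi (q ^ 9))" if "e \<in> {1, -1}" for e
    using id [OF that, of 1] unfolding A_explicit q by simp
  have A2: "1 / A 2 q - e * s ^ 3 * A 2 q =
      ramanujan_f (- e * s ^ 3) (- e * s ^ 15) * ramanujan_phi (e * s ^ 9) /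
      (ramanujan_f (- (q ^ 3)) (- (q ^ 6)) * ramanujan_psi (q ^ 9))" if "e \<in> {1, -1}" for e
    using id [OF that, of 3] unfolding A_explicit q by simp
  have A3: "1 / A 3 q - e * s ^ 5 * A 3 q =
      ramanujan_f (- e * s ^ 5) (- e * s ^ 13) * ramanujan_phi (e * s ^ 9) /
      (ramanujan_f (- (q ^ 2)) (- (q ^ 7)) * ramanujan_psi (q ^ 9))" if "e \<in> {1, -1}" for e
    using id [OF that, of 5] unfolding A_explicit q by simp
  have A4: "1 / A 4 q - e * s ^ 7 * A 4 q =
      ramanujan_f (- e * s ^ 7) (- e * s ^ 11) * ramanujan_phi (e * s ^ 9) /
      (ramanujan_f (- q) (- (q ^ 8)) * ramanujan_psi (q ^ 9))" if "e \<in> {1, -1}" for e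
    using id [OF that, of 7] assms(2) unfolding A_explicit q by simp
  \<comment> \<open>For (v): the factor \<open>Q\<close> occurs in all six theta functions and cancels.\<close>
  define Q where "Q = qpoch_inf (q ^ 9) (q ^ 9)"
  have q9: "norm (q ^ 9) < 1"
    using assms(1) by (simp add: norm_power power_less_one_iff)
  have Q0: "Q \<noteq> 0"
    unfolding Q_def by (intro qpoch_inf_nonzero q9)
  have num: "ramanujan_f (s ^ k) (s ^ (18 - k)) = qpoch_inf2 (- (s ^ k)) (- (s ^ (18 - k))) (q ^ 9) * Q"
    if "k \<le> 18" for k
  proof -
    have "s ^ k * s ^ (18 - k) = q ^ 9"
      using that by (simp add: q flip: power_add)
    then show ?thesis
      using jacobi_triple_product [of "s ^ k" "s ^ (18 - k)"] s0 q9
      by (simp add: qpoch_inf2_def Q_def)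
  qed
  have den: "ramanujan_f (- (q ^ k)) (- (q ^ (9 - k))) =
      qpoch_inf (q ^ k) (q ^ 9) * qpoch_inf (q ^ (9 - k)) (q ^ 9) * Q" if "k \<le> 9" for k
  proof -
    have "- (q ^ k) * - (q ^ (9 - k)) = q ^ 9"
      using that by (simp flip: power_add)
    then show ?thesis
      using jacobi_triple_product [of "- (q ^ k)" "- (q ^ (9 - k))"] False q9
      by (simp add: Q_def)
  qed
  have "(\<Prod>i\<in>{1, 3, 4}. 1 / A i q + s ^ (2 * i - 1) * A i q) =
      (ramanujan_f s (s ^ 17) * ramanujan_phi (- (s ^ 9)) /
        (ramanujan_f (- (q ^ 4)) (- (q ^ 5)) * ramanujan_psi (q ^ 9))) *
      ((ramanujan_f (s ^ 5) (s ^ 13) * ramanujan_phi (- (s ^ 9)) /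
        (ramanujan_f (- (q ^ 2)) (- (q ^ 7)) * ramanujan_psi (q ^ 9))) *
      (ramanujan_f (s ^ 7) (s ^ 11) * ramanujan_phi (- (s ^ 9)) /
        (ramanujan_f (- q) (- (q ^ 8)) * ramanujan_psi (q ^ 9))))"
    using A1 [of "- 1"] A3 [of "- 1"] A4 [of "- 1"] by simp
  also have "\<dots> = ramanujan_phi (- (s ^ 9)) ^ 3 /
           (ramanujan_psi (q ^ 9) ^ 3 * qpoch_inf2 q (q ^ 2) (q ^ 3)) *
           (qpoch_inf2 (- s) (- (s ^ 17)) (q ^ 9) *
           (qpoch_inf2 (- (s ^ 5)) (- (s ^ 13)) (q ^ 9) *
            qpoch_inf2 (- (s ^ 7)) (- (s ^ 11)) (q ^ 9)))"
  proof -
    have *: "n * Q * P / (a * b * Q * S) = n * P / (a * b * S)" for n P a b S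
      using Q0 by simp
    have "ramanujan_f s (s ^ 17) = qpoch_inf2 (- s) (- (s ^ 17)) (q ^ 9) * Q"
      "ramanujan_f (- q) (- (q ^ 8)) = qpoch_inf q (q ^ 9) * qpoch_inf (q ^ 8) (q ^ 9) * Q"
      using num [of 1] den [of 1] by simp_all
    moreover have "ramanujan_f (s ^ 5) (s ^ 13) = qpoch_inf2 (- (s ^ 5)) (- (s ^ 13)) (q ^ 9) * Q"
      "ramanujan_f (s ^ 7) (s ^ 11) = qpoch_inf2 (- (s ^ 7)) (- (s ^ 11)) (q ^ 9) * Q"
      "ramanujan_f (- (q ^ 4)) (- (q ^ 5)) = qpoch_inf (q ^ 4) (q ^ 9) * qpoch_inf (q ^ 5) (q ^ 9) * Q"
      "ramanujan_f (- (q ^ 2)) (- (q ^ 7)) = qpoch_inf (q ^ 2) (q ^ 9) * qpoch_inf (q ^ 7) (q ^ 9) * Q"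
      using num [of 5] num [of 7] den [of 4] den [of 2] by simp_all
    ultimately show ?thesis
      unfolding qpoch_product_mod_9 [OF assms(1)] power3_eq_cube [of "ramanujan_phi _"]
        power3_eq_cube [of "ramanujan_psi _"]
      by (simp only: *)
        (simp only: divide_divide_eq_left times_divide_times_eq times_divide_eq_left
          times_divide_eq_right mult_ac)
  qed
  finally have A5: "(\<Prod>i\<in>{1, 3, 4}. 1 / A i q + s ^ (2 * i - 1) * A i q) =
           ramanujan_phi (- (s ^ 9)) ^ 3 /
           (ramanujan_psi (q ^ 9) ^ 3 * qpoch_inf2 q (q ^ 2) (q ^ 3)) *
           (\<Prod>i\<in>{1, 3, 4}. qpoch_inf2 (- (s ^ (2 * i - 1))) (- (s ^ (18 - (2 * i - 1)))) (q ^ 9))"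
    by simp
  show ?thesis
    using A1 A2 A3 A4 A5 by blast
qed

end
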